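(* Let $s\ge 1$ be an integer, let $\gamma,\alpha\in(0,1)$, and consider testing the null hypotheses $H_i: P\in\omega_i$, $i=1,\ldots,s$, based on $p$-values $\hat p_1,\ldots,\hat p_s$ satisfying $$P\{\hat p_i\le u\}\le u\quad\text{for every } u\in(0,1)\text{ and every } P\in\omega_i ,\qquad i=1,\ldots,s,$$ with no assumption on the joint distribution of the $p$-values. Let $$\alpha_i=\frac{(\lfloor\gamma i\rfloor+1)\alpha}{s+\lfloor\gamma i\rfloor+1-i},\qquad i=1,\ldots,s,$$ and let $D(\gamma,s)$ be the constant defined in the context. Then the stepdown procedure with constants $\alpha_i''=\alpha_i/D(\gamma,s)$, $i=1,\ldots,s$, satisfies, for every $P\in\Omega$, $$P\{FDP>\gamma\}\le\alpha .$$
   Context: Setup. Data $X$ have distribution $P$ belonging to a model $\Omega$ (a family of probability distributions). Each null hypothesis $H_i$ is identified with a subset $\omega_i\subset\Omega$. For $P\in\Omega$, $I=I(P)=\{i: P\in\omega_i\}$ is the set of indices of true null hypotheses, and $|I|$ is its cardinality. The $p$-values $\hat p_1,\ldots,\hat p_s$ are $[0,1]$-valued statistics (functions of $X$). Stepdown procedure with constants $c_1\le c_2\le\cdots\le c_s$. Let $\hat p_{(1)}\le\cdots\le\hat p_{(s)}$ be the ordered $p$-values (ties broken arbitrarily) with corresponding hypotheses $H_{(1)},\ldots,H_{(s)}$. If $\hat p_{(1)}>c_1$, reject no hypotheses. Otherwise reject $H_{(1)},\ldots,H_{(r)}$, where $r$ is the largest index such that $\hat p_{(1)}\le c_1,\ldots,\hat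 p_{(r)}\le c_r$. False discovery proportion. $FDP$ is the number of rejected hypotheses $H_i$ with $i\in I(P)$ divided by the total number of rejected hypotheses, and $FDP=0$ if there are no rejections. The constant $D(\gamma,s)$. For an integer $1\le |I|\le s$ (here $|I|$ is treated as a variable integer), put $\beta_0=0$, $$\beta_m=\frac{m}{\max\{s+m-\lceil m/\gamma\rceil+1,\ |I|\}}\quad (m=1,\ldots,\lfloor\gamma s\rfloor),\qquad \beta_{\lfloor\gamma s\rfloor+1}=\frac{\lfloor\gamma s\rfloor+1}{|I|},$$ $$N=N(\gamma,s,|I|)=\min\Big\{\lfloor\gamma s\rfloor+1,\ |I|,\ \Big\lfloor\gamma\Big(\frac{s-|I|}{1-\gamma}+1\Big)\Big\rfloor+1\Big\},$$ $$S(\gamma,s,|I|)=|I|\sum_{i=1}^{N}\frac{\beta_i-\beta_{i-1}}{i},\qquad D(\gamma,s)=\max_{1\le|I|\le s}S(\gamma,s,|I|).$$ Here $\lfloor x\rfloor$ is the greatest integer $\le x$ and $\lceil x\rceil$ the least integer $\ge x$. *)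

theory Defs
  imports "HOL-Probability.Probability"
begin

(* Hypotheses are indexed by {1..s}; a set of hypotheses or of distributions is just a set. *)

definition true_nulls :: "nat \<Rightarrow> (nat \<Rightarrow> 'x measure set) \<Rightarrow> 'x measure \<Rightarrow> nat set" where
  "true_nulls s \<omega> P = {i \<in> {1..s}. P \<in> \<omega> i}"

(* \<sigma> lists the indices in order of increasing p-value: p (\<sigma> i) is the i-th ordered p-value and
   \<sigma> i the index of its hypothesis. With ties there are several such \<sigma>. *)
definition sorts_pvalues :: "nat \<Rightarrow> (nat \<Rightarrow> real) \<Rightarrow> (nat \<Rightarrow> nat) \<Rightarrow> bool" where
  "sorts_pvalues s p \<sigma> \<longleftrightarrow>
     bij_betw \<sigma> {1..s} {1..s} \<and> (\<forall>i\<in>{1..s}. \<forall>j\<in>{1..s}. i \<le> j \<longrightarrow> p (\<sigma> i) \<le> p (\<sigma> j))"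

(* The value 0 always qualifies, and it is the maximum exactly when p (\<sigma> 1) > c 1. *)
definition stepdown_count :: "nat \<Rightarrow> (nat \<Rightarrow> real) \<Rightarrow> (nat \<Rightarrow> real) \<Rightarrow> (nat \<Rightarrow> nat) \<Rightarrow> nat" where
  "stepdown_count s c p \<sigma> = Max {r \<in> {0..s}. \<forall>i\<in>{1..r}. p (\<sigma> i) \<le> c i}"

definition stepdown_rejects :: "nat \<Rightarrow> (nat \<Rightarrow> real) \<Rightarrow> (nat \<Rightarrow> real) \<Rightarrow> (nat \<Rightarrow> nat) \<Rightarrow> nat set" where
  "stepdown_rejects s c p \<sigma> = \<sigma> ` {1..stepdown_count s c p \<sigma>}"

definition FDP :: "nat set \<Rightarrow> nat set \<Rightarrow> real" where
  "FDP R I = (if R = {} then 0 else real (card (R \<inter> I)) / real (card R))"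

definition alpha_const :: "real \<Rightarrow> real \<Rightarrow> nat \<Rightarrow> nat \<Rightarrow> real" where
  "alpha_const \<gamma> \<alpha> s i =
     (of_int \<lfloor>\<gamma> * real i\<rfloor> + 1) * \<alpha> / (real s + of_int \<lfloor>\<gamma> * real i\<rfloor> + 1 - real i)"

(* In the following, k stands for the cardinality of the set of true nulls, treated as a
   variable. The last branch of beta is meant for m = floor (\<gamma> * s) + 1; larger m are never used.
   The subtraction in the denominator is on int, since the value can be negative. *)
definition beta :: "real \<Rightarrow> nat \<Rightarrow> nat \<Rightarrow> nat \<Rightarrow> real" where
  "beta \<gamma> s k m =
     (if m = 0 then 0
      else if int m \<le> \<lfloor>\<gamma> * real s\<rfloor>
        then real m / of_int (max (int s + int m - \<lceil>real m / \<gamma>\<rceil> + 1) (int k))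
      else (of_int \<lfloor>\<gamma> * real s\<rfloor> + 1) / real k)"

definition N_const :: "real \<Rightarrow> nat \<Rightarrow> nat \<Rightarrow> nat" where
  "N_const \<gamma> s k =
     nat (Min {\<lfloor>\<gamma> * real s\<rfloor> + 1, int k, \<lfloor>\<gamma> * ((real s - real k) / (1 - \<gamma>) + 1)\<rfloor> + 1})"

definition S_const :: "real \<Rightarrow> nat \<Rightarrow> nat \<Rightarrow> real" where
  "S_const \<gamma> s k =
     real k * (\<Sum>i = 1..N_const \<gamma> s k. (beta \<gamma> s k i - beta \<gamma> s k (i - 1)) / real i)"

definition D_const :: "real \<Rightarrow> nat \<Rightarrow> real" where
  "D_const \<gamma> s = Max (S_const \<gamma> s ` {1..s})"

end

theory Submission
  imports Defs
begin

text \<open>Suppose the false discovery proportion exceeds \<gamma>, and let j be the first index at which the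
  proportion of true nulls among the j smallest p-values exceeds \<gamma>. By minimality the number m of
  true nulls among them is \<lfloor>\<gamma> j\<rfloor> + 1, and since at most s - |I| of the hypotheses are false, the
  j-th critical constant is at most \<beta>(m) times \<alpha> / D, where m is at most N. Hence for some m up to N
  the m-th smallest true p-value is at most \<alpha> \<beta>(m) / D. A union-type bound valid under arbitrary
  dependence shows that this has probability at most \<alpha> S(|I|) / D, which is at most \<alpha>.\<close>

section \<open>Telescoping weights and a probability bound under arbitrary dependence\<close>

lemma sum_inverse_telescope:
  fixes j m :: nat
  assumes "1 \<le> j" "j \<le> m"
  shows "(\<Sum>i=j..m. 1 / real i - 1 / real (i + 1)) + 1 / real (m + 1) = 1 / real j"
  using assms(2)
proof (induction m rule: dec_induct)
  case base
  then show ?case by simp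
next
  case (step n)
  then show ?case by simp
qed

text \<open>Summation by parts. On the right the coefficients of the \<open>b i\<close> are
  nonnegative, so upper bounds can be inserted term by term; the differences on the left do not
  allow this.\<close>

lemma sum_Abel_inverse:
  fixes b :: "nat \<Rightarrow> real"
  assumes "b 0 = 0"
  shows "(\<Sum>i=1..m. (b i - b (i - 1)) / real i) =
    (\<Sum>i=1..m. (1 / real i - 1 / real (i + 1)) * b i) + b m / real (m + 1)"
proof (induction m)
  case 0
  then show ?case using assms by simp
next
  case (Suc m)
  then show ?case by (simp add: diff_divide_distrib left_diff_distrib)
qed

text \<open>From index j on, \<open>c\<close> is at least j, and the weights from j to m together
  with the boundary weight telescope to 1 / j. The terms before j only add nonnegative
  amounts.\<close>

lemma one_le_weighted_counts:
  fixes c :: "nat \<Rightarrow> real"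
  assumes "mono c" "\<And>i. 0 \<le> c i" "1 \<le> j" "j \<le> m" "real j \<le> c j"
  shows "1 \<le> (\<Sum>i=1..m. (1 / real i - 1 / real (i + 1)) * c i) + c m / real (m + 1)"
proof -
  have w: "0 \<le> 1 / real i - 1 / real (i + 1)" if "1 \<le> i" for i
    using that by (simp add: field_simps)
  have jc: "real j \<le> c i" if "j \<le> i" for i
    using assms(5) monoD[OF assms(1) that] by linarith
  have "1 = ((\<Sum>i=j..m. 1 / real i - 1 / real (i + 1)) + 1 / real (m + 1)) * real j"
    using sum_inverse_telescope[OF assms(3,4)] assms(3) by simp
  also have "\<dots> = (\<Sum>i=j..m. (1 / real i - 1 / real (i + 1)) * real j) + real j / real (m + 1)"
    by (simp add: distrib_right sum_distrib_right)
  also have "\<dots> \<le> (\<Sum>i=j..m. (1 / real i - 1 / real (i + 1)) * c i) + c m / real (m + 1)"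
    using assms(3,4) by (intro add_mono sum_mono mult_left_mono divide_right_mono w jc) auto
  also have "(\<Sum>i=j..m. (1 / real i - 1 / real (i + 1)) * c i)
      \<le> (\<Sum>i=1..m. (1 / real i - 1 / real (i + 1)) * c i)"
    using assms(2,3) by (intro sum_mono2 mult_nonneg_nonneg w) auto
  finally show ?thesis by simp
qed

text \<open>A true p-value lying in the interval from b (i - 1) to b i is given the weight 1 / i; the
  weights add up to at least 1 on the event. Abel summation turns the expected total weight, which
  is linear in the probabilities of the events that q l is at most b i, into the stated bound.\<close>

lemma (in prob_space) prob_ordered_le:
  fixes q :: "'i \<Rightarrow> 'a \<Rightarrow> real" and b :: "nat \<Rightarrow> real"
  assumes "finite I"
    and [measurable]: "\<And>l. l \<in> I \<Longrightarrow> q l \<in> borel_measurable M"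
    and "mono b" "b 0 = 0"
    and valid: "\<And>l i. l \<in> I \<Longrightarrow> 1 \<le> i \<Longrightarrow> prob {x \<in> space M. q l x \<le> b i} \<le> b i"
    and "F \<in> events"
    and F: "\<And>x. x \<in> F \<Longrightarrow> \<exists>j\<in>{1..m}. j \<le> card {l \<in> I. q l x \<le> b j}"
  shows "prob F \<le> real (card I) * (\<Sum>i=1..m. (b i - b (i - 1)) / real i)"
\<comment> \<open>For m = 0 there is no admissible j, so \<open>F\<close> is empty. For positive m
  the marginal bounds, which start at index 1, also cover the boundary term at m.\<close>
proof (cases "m = 0")
  case True
  then have "F = {}" using F by auto
  with True show ?thesis by simp
next
  case False
  define A where "A l i = {x \<in> space M. q l x \<le> b i}" for l i
  \<comment> \<open>The number of l with \<open>q l x\<close> at most \<open>b i\<close>, written as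
    a sum of indicators so that its expectation splits into marginal probabilities.\<close>
  define c where "c x i = (\<Sum>l\<in>I. indicator (A l i) x :: real)" for x i
  define w where "w i = 1 / real i - 1 / real (i + 1)" for i
  have A: "A l i \<in> events" if "l \<in> I" for l i
    unfolding A_def using that by measurable
  have int_c: "integrable M (\<lambda>x. c x i)" for i
    unfolding c_def using A by (intro Bochner_Integration.integrable_sum) (auto simp: emeasure_eq_measure)
  have exp_c: "expectation (\<lambda>x. c x i) = (\<Sum>l\<in>I. prob (A l i))" for i
    unfolding c_def using A
    by (subst Bochner_Integration.integral_sum) (auto simp: emeasure_eq_measure)
  have exp_le: "expectation (\<lambda>x. c x i) \<le> real (card I) * b i" if "1 \<le> i" for i
    using sum_bounded_above[of I "\<lambda>l. prob (A l i)" "b i"] valid that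
    unfolding exp_c by (auto simp: A_def)
  have one_le: "1 \<le> (\<Sum>i=1..m. w i * c x i) + c x m / real (m + 1)" if xF: "x \<in> F" for x
  proof -
    obtain j where j: "j \<in> {1..m}" "j \<le> card {l \<in> I. q l x \<le> b j}" using F[OF xF] by blast
    have x: "x \<in> space M" using xF \<open>F \<in> events\<close> sets.sets_into_space by blast
    have "c x i = real (card {l \<in> I. q l x \<le> b i})" for i
      using x \<open>finite I\<close>
      by (simp add: c_def A_def indicator_def sum.If_cases Int_def flip: sum.inter_filter)
    moreover have "mono (c x)"
      unfolding c_def A_def
      by (intro monoI sum_mono) (auto simp: indicator_def intro: order_trans monoD[OF \<open>mono b\<close>])
    moreover have "0 \<le> c x i" for i unfolding c_def by (simp add: sum_nonneg)
    moreover have "real j \<le> c x j" using j(2) calculation(1) by simp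
    ultimately show ?thesis
      unfolding w_def using j(1) by (intro one_le_weighted_counts[of "c x" j]) auto
  qed
  have c0: "0 \<le> c x i" for x i unfolding c_def by (simp add: sum_nonneg)
  have w0: "0 \<le> w i" if "1 \<le> i" for i
    using that by (simp add: w_def field_simps)
  have "prob F = expectation (indicator F)" using \<open>F \<in> events\<close> by simp
  also have "\<dots> \<le> expectation (\<lambda>x. (\<Sum>i=1..m. w i * c x i) + c x m / real (m + 1))"
  proof (rule integral_mono)
    show "integrable M (indicator F :: 'a \<Rightarrow> real)"
      using \<open>F \<in> events\<close> by (simp add: emeasure_eq_measure)
    show "integrable M (\<lambda>x. (\<Sum>i=1..m. w i * c x i) + c x m / real (m + 1))"
      using int_c by auto
    show "indicator F x \<le> (\<Sum>i=1..m. w i * c x i) + c x m / real (m + 1)" if "x \<in> space M" for x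
    proof (cases "x \<in> F")
      case False
      then show ?thesis using c0 w0 by (auto intro!: add_nonneg_nonneg sum_nonneg)
    qed (use one_le in simp)
  qed
  also have "\<dots> = (\<Sum>i=1..m. w i * expectation (\<lambda>x. c x i)) + expectation (\<lambda>x. c x m) / real (m + 1)"
    using int_c by (simp add: Bochner_Integration.integral_sum)
  \<comment> \<open>Only marginal probabilities remain here, which is why the dependence between the
    \<open>q l\<close> is irrelevant.\<close>
  also have "\<dots> \<le> (\<Sum>i=1..m. w i * (real (card I) * b i)) + real (card I) * b m / real (m + 1)"
    using False by (intro add_mono sum_mono mult_left_mono divide_right_mono exp_le w0) auto
  also have "\<dots> = real (card I) * ((\<Sum>i=1..m. w i * b i) + b m / real (m + 1))"
    by (simp add: sum_distrib_left distrib_left mult.left_commute)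
  also have "(\<Sum>i=1..m. w i * b i) + b m / real (m + 1) = (\<Sum>i=1..m. (b i - b (i - 1)) / real i)"
    unfolding w_def using sum_Abel_inverse[of b m] \<open>b 0 = 0\<close> by simp
  finally show ?thesis .
qed

section \<open>The stepdown procedure for a fixed outcome\<close>

lemma stepdown_count_le: "stepdown_count s c p \<sigma> \<le> s"
  and stepdown_count_bound: "i \<in> {1..stepdown_count s c p \<sigma>} \<Longrightarrow> p (\<sigma> i) \<le> c i"
  and le_stepdown_countI:
    "r \<le> s \<Longrightarrow> (\<And>i. i \<in> {1..r} \<Longrightarrow> p (\<sigma> i) \<le> c i) \<Longrightarrow> r \<le> stepdown_count s c p \<sigma>"
proof -
  let ?A = "{r \<in> {0..s}. \<forall>i\<in>{1..r}. p (\<sigma> i) \<le> c i}"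
  have "finite ?A" by simp
  moreover have "0 \<in> ?A" by simp
  ultimately have "Max ?A \<in> ?A" "\<And>r. r \<in> ?A \<Longrightarrow> r \<le> Max ?A"
    using Max_in[of ?A] Max_ge[of ?A] by blast+
  then have M: "stepdown_count s c p \<sigma> \<in> ?A"
    and le: "\<And>r. r \<in> ?A \<Longrightarrow> r \<le> stepdown_count s c p \<sigma>"
    unfolding stepdown_count_def .
  show "stepdown_count s c p \<sigma> \<le> s" using M by simp
  show "p (\<sigma> i) \<le> c i" if "i \<in> {1..stepdown_count s c p \<sigma>}"
    using M that by blast
  show "r \<le> stepdown_count s c p \<sigma>" if "r \<le> s" "\<And>i. i \<in> {1..r} \<Longrightarrow> p (\<sigma> i) \<le> c i"
    by (rule le) (simp add: that)
qed

text \<open>Expresses an order statistic by a count that does not mention \<sigma>. This removes the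
  tie-breaking from the rejection set and later gives measurability from the p-values alone.\<close>

lemma ordered_pvalue_le_iff:
  assumes \<sigma>: "sorts_pvalues s p \<sigma>" and j: "j \<in> {1..s}"
  shows "p (\<sigma> j) \<le> u \<longleftrightarrow> j \<le> card {l \<in> {1..s}. p l \<le> u}"
proof -
  have bij: "bij_betw \<sigma> {1..s} {1..s}"
    and ord: "\<And>i j. i \<in> {1..s} \<Longrightarrow> j \<in> {1..s} \<Longrightarrow> i \<le> j \<Longrightarrow> p (\<sigma> i) \<le> p (\<sigma> j)"
    using \<sigma> unfolding sorts_pvalues_def by blast+
  have im: "\<sigma> i \<in> {1..s}" if "i \<in> {1..s}" for i
    using bij that by (rule bij_betwE[rule_format])
  show ?thesis
  proof
    assume u: "p (\<sigma> j) \<le> u"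
    have "\<sigma> ` {1..j} \<subseteq> {l \<in> {1..s}. p l \<le> u}"
    proof (rule image_subsetI)
      fix i assume "i \<in> {1..j}"
      then have i: "i \<in> {1..s}" "i \<le> j" using j by auto
      show "\<sigma> i \<in> {l \<in> {1..s}. p l \<le> u}" using im[OF i(1)] ord[OF i(1) j i(2)] u by simp
    qed
    then have "card (\<sigma> ` {1..j}) \<le> card {l \<in> {1..s}. p l \<le> u}"
      by (rule card_mono[rotated]) simp
    moreover have "card (\<sigma> ` {1..j}) = j"
      using inj_on_subset[OF bij_betw_imp_inj_on[OF bij], of "{1..j}"] j by (simp add: card_image)
    ultimately show "j \<le> card {l \<in> {1..s}. p l \<le> u}" by simp
  next
    assume le: "j \<le> card {l \<in> {1..s}. p l \<le> u}"
    show "p (\<sigma> j) \<le> u"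
    proof (rule ccontr)
      assume u: "\<not> p (\<sigma> j) \<le> u"
      \<comment> \<open>If the j-th ordered value exceeds u, values at most u occupy only positions
        before j, so there are at most j - 1 of them.\<close>
      have "{l \<in> {1..s}. p l \<le> u} \<subseteq> \<sigma> ` {1..<j}"
      proof
        fix l assume l: "l \<in> {l \<in> {1..s}. p l \<le> u}"
        then obtain i where i: "i \<in> {1..s}" "l = \<sigma> i"
          using bij_betw_imp_surj_on[OF bij] by blast
        have "i < j" using ord[OF j i(1)] u l i by force
        with i show "l \<in> \<sigma> ` {1..<j}" by auto
      qed
      then have "card {l \<in> {1..s}. p l \<le> u} \<le> card (\<sigma> ` {1..<j})"
        by (rule card_mono[rotated]) simp
      also have "\<dots> \<le> j - 1" using card_image_le[of "{1..<j}" \<sigma>] by simp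
      finally show False using le j by auto
    qed
  qed
qed

text \<open>Monotonicity of the constants makes the set of rejected hypotheses independent of the way
  ties are broken.\<close>

lemma stepdown_rejects_eq:
  assumes \<sigma>: "sorts_pvalues s p \<sigma>" and c: "mono_on {1..s} c"
  shows "stepdown_rejects s c p \<sigma> =
    {i \<in> {1..s}. \<exists>r\<in>{1..s}. p i \<le> c r \<and> (\<forall>j\<in>{1..r}. j \<le> card {l \<in> {1..s}. p l \<le> c j})}"
    (is "?R = ?G")
proof -
  let ?n = "stepdown_count s c p \<sigma>"
  have bij: "bij_betw \<sigma> {1..s} {1..s}"
    and ord: "\<And>i j. i \<in> {1..s} \<Longrightarrow> j \<in> {1..s} \<Longrightarrow> i \<le> j \<Longrightarrow> p (\<sigma> i) \<le> p (\<sigma> j)"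
    using \<sigma> unfolding sorts_pvalues_def by blast+
  have im: "\<sigma> i \<in> {1..s}" if "i \<in> {1..s}" for i
    using bij that by (rule bij_betwE[rule_format])
  have n: "?n \<le> s" by (rule stepdown_count_le)
  show ?thesis
  proof (intro equalityI subsetI)
    fix l assume "l \<in> ?R"
    then obtain i where i: "i \<in> {1..?n}" "l = \<sigma> i" unfolding stepdown_rejects_def by blast
    have "p l \<le> c ?n"
      using ord[of i ?n] stepdown_count_bound[of ?n s c p \<sigma>] i n by simp
    moreover have "j \<le> card {l \<in> {1..s}. p l \<le> c j}" if "j \<in> {1..?n}" for j
      using stepdown_count_bound[OF that] ordered_pvalue_le_iff[OF \<sigma>, of j "c j"] that n by simp
    ultimately show "l \<in> ?G" using i n im[of i] by (auto intro!: bexI[of _ ?n])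
  next
    fix l assume "l \<in> ?G"
    then obtain r where r: "l \<in> {1..s}" "r \<in> {1..s}" "p l \<le> c r"
      "\<And>j. j \<in> {1..r} \<Longrightarrow> j \<le> card {l \<in> {1..s}. p l \<le> c j}" by blast
    obtain i where i: "i \<in> {1..s}" "l = \<sigma> i"
      using bij_betw_imp_surj_on[OF bij] r(1) by blast
    have "p (\<sigma> j) \<le> c j" if "j \<in> {1..r}" for j
      using r(2) r(4)[OF that] ordered_pvalue_le_iff[OF \<sigma>, of j "c j"] that by simp
    then have rn: "r \<le> ?n" using r(2) by (intro le_stepdown_countI) auto
    \<comment> \<open>Otherwise position \<open>Suc ?n\<close> would pass too: its p-value is at
      most the one at i, hence at most \<open>c r\<close>, and r lies below \<open>Suc ?n\<close>.
      This contradicts the maximality of \<open>?n\<close>.\<close>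
    have "i \<le> ?n"
    proof (rule ccontr)
      assume "\<not> i \<le> ?n"
      then have t: "Suc ?n \<in> {1..s}" "Suc ?n \<le> i" using i by auto
      have "p (\<sigma> (Suc ?n)) \<le> c r" using ord[OF t(1) i(1) t(2)] r(3) i by simp
      also have "\<dots> \<le> c (Suc ?n)" using rn r(2) t(1) by (intro mono_onD[OF c]) auto
      finally have "p (\<sigma> j) \<le> c j" if "j \<in> {1..Suc ?n}" for j
        using that stepdown_count_bound[of j s c p \<sigma>] by (cases "j = Suc ?n") auto
      then have "Suc ?n \<le> ?n" using t(1) by (intro le_stepdown_countI) auto
      then show False by simp
    qed
    then show "l \<in> ?R" using i unfolding stepdown_rejects_def by auto
  qed
qed

text \<open>The inequality \<open>real m - 1 \<le> \<gamma> * (real j - 1)\<close> is recorded next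
  to the floor identity because the third bound in \<open>N_const\<close> is derived from it. The
  difference j - m counts the false hypotheses among the first j.\<close>

lemma FDP_exceeds_imp_first_index:
  assumes \<sigma>: "sorts_pvalues s p \<sigma>" and "0 < \<gamma>" "I \<subseteq> {1..s}"
    and fdp: "FDP (stepdown_rejects s c p \<sigma>) I > \<gamma>"
  obtains j m where "j \<in> {1..s}" "m = card (\<sigma> ` {1..j} \<inter> I)"
    "int m = \<lfloor>\<gamma> * real j\<rfloor> + 1" "real m - 1 \<le> \<gamma> * (real j - 1)" "j - m \<le> s - card I"
    "m \<le> card {l \<in> I. p l \<le> c j}" "m \<le> j"
proof -
  let ?n = "stepdown_count s c p \<sigma>"
  define V where "V j = card (\<sigma> ` {1..j} \<inter> I)" for j
  have bij: "bij_betw \<sigma> {1..s} {1..s}"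
    and ord: "\<And>i j. i \<in> {1..s} \<Longrightarrow> j \<in> {1..s} \<Longrightarrow> i \<le> j \<Longrightarrow> p (\<sigma> i) \<le> p (\<sigma> j)"
    using \<sigma> unfolding sorts_pvalues_def by blast+
  have im: "\<sigma> i \<in> {1..s}" if "i \<in> {1..s}" for i
    using bij that by (rule bij_betwE[rule_format])
  have cardim: "card (\<sigma> ` {1..j}) = j" if "j \<le> s" for j
    using inj_on_subset[OF bij_betw_imp_inj_on[OF bij], of "{1..j}"] that by (simp add: card_image)
  have n: "?n \<le> s" by (rule stepdown_count_le)
  have n0: "?n \<noteq> 0"
  proof
    assume "?n = 0"
    then have "stepdown_rejects s c p \<sigma> = {}" by (simp add: stepdown_rejects_def)
    then show False using fdp \<open>0 < \<gamma>\<close> by (simp add: FDP_def)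
  qed
  have "FDP (stepdown_rejects s c p \<sigma>) I = real (V ?n) / real ?n"
    using n0 cardim[OF n] by (simp add: FDP_def stepdown_rejects_def V_def)
  then have Vn: "\<gamma> * real ?n < real (V ?n)" using fdp n0 by (simp add: pos_less_divide_eq)
  \<comment> \<open>The final count \<open>?n\<close> witnesses existence, and minimality gives j at
    most \<open>?n\<close>, so position j passes its own threshold.\<close>
  define j where "j = (LEAST j. \<gamma> * real j < real (V j))"
  have j: "\<gamma> * real j < real (V j)" unfolding j_def by (rule LeastI[of _ ?n]) (rule Vn)
  have jn: "j \<le> ?n" unfolding j_def by (rule Least_le) (rule Vn)
  \<comment> \<open>The strict inequality fails at 0, so j - 1 is a true predecessor and falls below
    the least index.\<close>
  have j0: "j \<noteq> 0" using j by (intro notI) (simp add: V_def)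
  have Vj1: "real (V (j - 1)) \<le> \<gamma> * real (j - 1)"
    using not_less_Least[of "j - 1" "\<lambda>j. \<gamma> * real j < real (V j)"] j0
    unfolding j_def[symmetric] by simp
  have "\<sigma> ` {1..j} \<inter> I \<subseteq> insert (\<sigma> j) (\<sigma> ` {1..j - 1} \<inter> I)"
  proof -
    have "{1..j} = insert j {1..j - 1}" using j0 by auto
    then show ?thesis by auto
  qed
  then have "V j \<le> card (insert (\<sigma> j) (\<sigma> ` {1..j - 1} \<inter> I))"
    unfolding V_def by (intro card_mono) auto
  also have "\<dots> \<le> Suc (V (j - 1))" unfolding V_def by (intro card_insert_le_m1) auto
  finally have "V j \<le> Suc (V (j - 1))" .
  then have m1: "real (V j) - 1 \<le> \<gamma> * (real j - 1)" using Vj1 j0 by (simp add: of_nat_diff)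
  \<comment> \<open>The floor is squeezed by V j - 1 \<le> \<gamma> (j - 1) \<le> \<gamma> j < V
    j.\<close>
  have m: "int (V j) = \<lfloor>\<gamma> * real j\<rfloor> + 1"
  proof -
    have "real (V j) - 1 \<le> \<gamma> * real j" using m1 \<open>0 < \<gamma>\<close> by (simp add: algebra_simps)
    then have "\<lfloor>\<gamma> * real j\<rfloor> = int (V j) - 1" using j by (intro floor_unique) auto
    then show ?thesis by simp
  qed
  have js: "j \<in> {1..s}" using jn j0 n by auto
  have finI: "finite I" using \<open>I \<subseteq> {1..s}\<close> finite_subset by blast
  have "j - V j = card (\<sigma> ` {1..j} - I)"
    using cardim[of j] js by (simp add: V_def card_Diff_subset_Int)
  also have "\<dots> \<le> card ({1..s} - I)"
  proof (rule card_mono)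
    have "{1..j} \<subseteq> {1..s}" using js by simp
    then have "\<sigma> ` {1..j} \<subseteq> {1..s}" using im by blast
    then show "\<sigma> ` {1..j} - I \<subseteq> {1..s} - I" by blast
  qed simp
  also have "\<dots> = s - card I" using \<open>I \<subseteq> {1..s}\<close> finI by (simp add: card_Diff_subset)
  finally have d: "j - V j \<le> s - card I" .
  have pj: "p (\<sigma> j) \<le> c j" using stepdown_count_bound[of j s c p \<sigma>] jn j0 by simp
  have "\<sigma> ` {1..j} \<inter> I \<subseteq> {l \<in> I. p l \<le> c j}"
  proof
    fix l assume "l \<in> \<sigma> ` {1..j} \<inter> I"
    then obtain i where i: "i \<in> {1..j}" "l = \<sigma> i" "l \<in> I" by blast
    have "p (\<sigma> i) \<le> p (\<sigma> j)" using i(1) js by (intro ord) auto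
    then show "l \<in> {l \<in> I. p l \<le> c j}" using pj i by simp
  qed
  then have cd: "V j \<le> card {l \<in> I. p l \<le> c j}"
    unfolding V_def using finI by (intro card_mono) auto
  have "V j \<le> card (\<sigma> ` {1..j})" unfolding V_def by (intro card_mono) auto
  then have "V j \<le> j" using cardim[of j] js by simp
  then show thesis using that[OF js V_def m m1 d cd] by simp
qed

section \<open>Properties of the constants\<close>

lemma alpha_const_mono:
  assumes "0 < \<gamma>" "0 \<le> \<alpha>"
  shows "mono_on {1..s} (alpha_const \<gamma> \<alpha> s)"
proof (rule mono_onI)
  fix i j assume ij: "i \<in> {1..s}" "j \<in> {1..s}" "i \<le> j"
  define a b where "a = real_of_int \<lfloor>\<gamma> * real i\<rfloor>" and "b = real_of_int \<lfloor>\<gamma> * real j\<rfloor>"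
  have "\<lfloor>\<gamma> * real i\<rfloor> \<le> \<lfloor>\<gamma> * real j\<rfloor>"
    using ij assms by (intro floor_mono mult_left_mono) auto
  then have ab: "0 \<le> a" "a \<le> b" using assms by (auto simp: a_def b_def)
  \<comment> \<open>This is the cross-multiplied claim after the common product (a + 1) (b + 1) has
    been cancelled.\<close>
  have "(a + 1) * (real s - real j) \<le> (b + 1) * (real s - real i)"
    using ij ab by (intro mult_mono) auto
  then have "(a + 1) * (real s + b + 1 - real j) \<le> (b + 1) * (real s + a + 1 - real i)"
    by (simp add: algebra_simps)
  then have "(a + 1) / (real s + a + 1 - real i) \<le> (b + 1) / (real s + b + 1 - real j)"
    using ij ab by (simp add: divide_simps)
  from mult_right_mono[OF this assms(2)]
  show "alpha_const \<gamma> \<alpha> s i \<le> alpha_const \<gamma> \<alpha> s j"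
    by (simp add: alpha_const_def a_def b_def)
qed

lemma beta_0 [simp]: "beta \<gamma> s k 0 = 0"
  by (simp add: beta_def)

text \<open>Below the last branch the denominator does not grow: m rises by 1 while the ceiling of m
  / \<gamma> rises by at least 1, since 1 / \<gamma> exceeds 1. At the junction it becomes k, which
  every earlier denominator dominates; afterwards \<open>beta\<close> is constant.\<close>

lemma beta_mono:
  assumes "0 < \<gamma>" "\<gamma> < 1" "1 \<le> k"
  shows "mono (beta \<gamma> s k)"
proof (rule incseq_SucI)
  fix m
  have fl: "0 \<le> \<lfloor>\<gamma> * real s\<rfloor>" using assms by simp
  consider "m = 0" | "m \<noteq> 0" "int (Suc m) \<le> \<lfloor>\<gamma> * real s\<rfloor>"
    | "m \<noteq> 0" "int m = \<lfloor>\<gamma> * real s\<rfloor>" | "\<lfloor>\<gamma> * real s\<rfloor> < int m" by linarith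
  then show "beta \<gamma> s k m \<le> beta \<gamma> s k (Suc m)"
  proof cases
    case 1
    then show ?thesis using fl assms by (auto simp: beta_def)
  next
    case 2
    have "real m / \<gamma> + 1 \<le> real (Suc m) / \<gamma>" using assms by (simp add: field_simps)
    then have "\<lceil>real m / \<gamma>\<rceil> + 1 \<le> \<lceil>real (Suc m) / \<gamma>\<rceil>"
      by (metis ceiling_add_one ceiling_mono)
    then show ?thesis
      using 2 assms unfolding beta_def
      by (auto intro!: frac_le)
  next
    case 3
    have "real m / real_of_int (max (int s + int m - \<lceil>real m / \<gamma>\<rceil> + 1) (int k)) \<le> (real m + 1) / real k"
      using assms by (intro frac_le) auto
    moreover have "real_of_int \<lfloor>\<gamma> * real s\<rfloor> = real m" using 3(2) by linarith
    moreover have "int m \<le> \<lfloor>\<gamma> * real s\<rfloor>" "\<not> int (Suc m) \<le> \<lfloor>\<gamma> * real s\<rfloor>"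
      using 3(2) by linarith+
    ultimately show ?thesis using 3(1) by (simp only: beta_def if_True if_False nat.distinct)
  next
    case 4
    then show ?thesis using fl by (simp add: beta_def)
  qed
qed

lemma beta_pos:
  assumes "0 < \<gamma>" "1 \<le> k" "1 \<le> m"
  shows "0 < beta \<gamma> s k m"
proof -
  have "0 < real_of_int \<lfloor>\<gamma> * real s\<rfloor> + 1" using assms by (intro add_nonneg_pos) simp_all
  then show ?thesis using assms by (simp add: beta_def less_max_iff_disj)
qed

lemma N_const_ge_1:
  assumes "0 < \<gamma>" "\<gamma> < 1" "1 \<le> k" "k \<le> s"
  shows "1 \<le> N_const \<gamma> s k"
proof -
  have "0 \<le> \<lfloor>\<gamma> * real s\<rfloor>" "0 \<le> \<lfloor>\<gamma> * ((real s - real k) / (1 - \<gamma>) + 1)\<rfloor>"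
    using assms by simp_all
  then have "1 \<le> min (\<lfloor>\<gamma> * real s\<rfloor> + 1)
      (min (int k) (\<lfloor>\<gamma> * ((real s - real k) / (1 - \<gamma>) + 1)\<rfloor> + 1))"
    using assms by linarith
  then have "nat 1 \<le> nat (min (\<lfloor>\<gamma> * real s\<rfloor> + 1)
      (min (int k) (\<lfloor>\<gamma> * ((real s - real k) / (1 - \<gamma>) + 1)\<rfloor> + 1)))"
    by (rule nat_mono)
  then show ?thesis by (simp add: N_const_def)
qed

text \<open>The term at 1 is present and equals \<open>beta \<gamma> s k 1\<close>; the others are
  nonnegative by monotonicity. Hence the maximum \<open>D_const\<close> is positive and may be
  divided by.\<close>

lemma S_const_pos:
  assumes "0 < \<gamma>" "\<gamma> < 1" "1 \<le> k" "k \<le> s"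
  shows "0 < S_const \<gamma> s k"
proof -
  have "0 < (\<Sum>i = 1..N_const \<gamma> s k. (beta \<gamma> s k i - beta \<gamma> s k (i - 1)) / real i)"
  proof (rule sum_pos2[of _ 1])
    show "0 < (beta \<gamma> s k 1 - beta \<gamma> s k (1 - 1)) / real 1"
      using beta_pos[of \<gamma> k 1 s] assms by simp
    show "0 \<le> (beta \<gamma> s k i - beta \<gamma> s k (i - 1)) / real i" for i
      using monoD[OF beta_mono[of \<gamma> k s], of "i - 1" i] assms by simp
  qed (use N_const_ge_1[OF assms] in auto)
  then show ?thesis using assms by (simp add: S_const_def)
qed

text \<open>The critical constant is \<alpha> m / (s + m - j), so only denominators are compared.
  The floor identity bounds j by the ceiling of m / \<gamma> minus 1, and
  \<open>j - m \<le> s - k\<close> gives k \<le> s + m - j; these are the two entries of the maximum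
  in \<open>beta\<close>.\<close>

lemma alpha_const_le_beta:
  assumes "0 < \<gamma>" "\<gamma> < 1" "0 \<le> \<alpha>" "1 \<le> k" "k \<le> s" "j \<in> {1..s}"
    and m: "int m = \<lfloor>\<gamma> * real j\<rfloor> + 1" and "m \<le> j" "j - m \<le> s - k"
  shows "alpha_const \<gamma> \<alpha> s j \<le> \<alpha> * beta \<gamma> s k m"
proof -
  have k: "k + j \<le> s + m" using assms by linarith
  have "0 \<le> \<lfloor>\<gamma> * real j\<rfloor>" using assms by simp
  then have m1: "1 \<le> m" using m by linarith
  have rm: "real_of_int \<lfloor>\<gamma> * real j\<rfloor> + 1 = real m" using m by linarith
  have a: "alpha_const \<gamma> \<alpha> s j = \<alpha> * (real m / (real s + real m - real j))"
    unfolding alpha_const_def by (simp only: rm[symmetric] times_divide_eq_right mult.commute add.assoc)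
  have le: "m \<le> \<lfloor>\<gamma> * real s\<rfloor> + 1"
    using m assms by (simp add: floor_mono)
  have "real m / (real s + real m - real j) \<le> beta \<gamma> s k m"
  proof (cases "int m \<le> \<lfloor>\<gamma> * real s\<rfloor>")
    case True
    have "\<gamma> * real j < real m" using rm by linarith
    then have "real j < real m / \<gamma>" using assms by (simp add: field_simps)
    \<comment> \<open>Strictness here accounts for the + 1 in the denominator of
      \<open>beta\<close>.\<close>
    then have "int j < \<lceil>real m / \<gamma>\<rceil>" by (simp add: less_ceiling_iff)
    then have "max (int s + int m - \<lceil>real m / \<gamma>\<rceil> + 1) (int k) \<le> int s + int m - int j"
      using k by auto
    then have "real_of_int (max (int s + int m - \<lceil>real m / \<gamma>\<rceil> + 1) (int k)) \<le> real_of_int (int s + int m - int j)"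
      by (rule of_int_le_iff[THEN iffD2])
    moreover have "0 < real_of_int (max (int s + int m - \<lceil>real m / \<gamma>\<rceil> + 1) (int k))"
      using assms by (simp add: less_max_iff_disj)
    ultimately have "real m / real_of_int (int s + int m - int j) \<le>
        real m / real_of_int (max (int s + int m - \<lceil>real m / \<gamma>\<rceil> + 1) (int k))"
      by (intro frac_le of_nat_0_le_iff order_refl)
    then show ?thesis using True m1 by (simp add: beta_def)
  next
    case False
    \<comment> \<open>Since j is at most s, m can exceed the floor of \<gamma> s by 1 only, which is
      the case meant by the last branch of \<open>beta\<close>.\<close>
    then have "real m = real_of_int \<lfloor>\<gamma> * real s\<rfloor> + 1" using le by linarith
    moreover have "real m / (real s + real m - real j) \<le> real m / real k"
      using k assms by (intro divide_left_mono) auto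
    ultimately show ?thesis using False m1 by (simp add: beta_def)
  qed
  then show ?thesis unfolding a using assms by (intro mult_left_mono) auto
qed

text \<open>The first bound comes from j \<le> s. For the third, at most s - k false hypotheses
  precede or occupy position j, while m - 1 \<le> \<gamma> (j - 1) makes them at least (1 -
  \<gamma>) (j - 1); this bounds j.\<close>

lemma index_le_N_const:
  assumes "0 < \<gamma>" "\<gamma> < 1" "k \<le> s" "j \<in> {1..s}" "m \<le> k"
    and m: "int m = \<lfloor>\<gamma> * real j\<rfloor> + 1" "real m - 1 \<le> \<gamma> * (real j - 1)" and "m \<le> j" "j - m \<le> s - k"
  shows "m \<le> N_const \<gamma> s k"
proof -
  have "int m \<le> \<lfloor>\<gamma> * real s\<rfloor> + 1" using m assms by (simp add: floor_mono)
  moreover have "int m \<le> \<lfloor>\<gamma> * ((real s - real k) / (1 - \<gamma>) + 1)\<rfloor> + 1"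
  proof -
    have "real j - real m \<le> real s - real k" using assms by linarith
    then have "(1 - \<gamma>) * (real j - 1) \<le> real s - real k" using m(2) by (simp add: algebra_simps)
    then have "real j - 1 \<le> (real s - real k) / (1 - \<gamma>)" using assms by (simp add: field_simps)
    then have "\<gamma> * real j \<le> \<gamma> * ((real s - real k) / (1 - \<gamma>) + 1)"
      using assms by (intro mult_left_mono) auto
    from floor_mono[OF this] show ?thesis using m(1) by simp
  qed
  ultimately show ?thesis using assms by (simp add: N_const_def)
qed

section \<open>Measurability and the final estimate\<close>

lemma measurable_card_le [measurable]:
  fixes q :: "'i \<Rightarrow> 'a \<Rightarrow> real"
  assumes "finite I" and [measurable]: "\<And>l. l \<in> I \<Longrightarrow> q l \<in> borel_measurable M"
  shows "Measurable.pred M (\<lambda>x. j \<le> card {l \<in> I. q l x \<le> u})"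
proof -
  have "j \<le> card {l \<in> I. q l x \<le> u} \<longleftrightarrow> real j \<le> (\<Sum>l\<in>I. if q l x \<le> u then 1 else 0)" for x
    using assms(1) by (simp flip: sum.inter_filter)
  then show ?thesis by simp
qed

theorem theorem3p4:
  fixes s :: nat and \<gamma> \<alpha> :: real
    and M :: "'x measure" and \<Omega> :: "'x measure set"
    and \<omega> :: "nat \<Rightarrow> 'x measure set"
    and p :: "nat \<Rightarrow> 'x \<Rightarrow> real"
    and \<sigma> :: "'x \<Rightarrow> nat \<Rightarrow> nat"
  assumes "s \<ge> 1" and "0 < \<gamma>" "\<gamma> < 1" and "0 < \<alpha>" "\<alpha> < 1"
    and model: "\<And>Q. Q \<in> \<Omega> \<Longrightarrow> prob_space Q \<and> sets Q = sets M"
    and nulls: "\<And>i. i \<in> {1..s} \<Longrightarrow> \<omega> i \<subseteq> \<Omega>"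
    and pvalues_measurable: "\<And>i. i \<in> {1..s} \<Longrightarrow> p i \<in> borel_measurable M"
    and pvalues_range: "\<And>i x. i \<in> {1..s} \<Longrightarrow> x \<in> space M \<Longrightarrow> p i x \<in> {0..1}"
    and pvalues_valid: "\<And>i Q u. i \<in> {1..s} \<Longrightarrow> Q \<in> \<omega> i \<Longrightarrow> 0 < u \<Longrightarrow> u < 1 \<Longrightarrow>
          measure Q {x \<in> space Q. p i x \<le> u} \<le> u"
    and ordering: "\<And>x. x \<in> space M \<Longrightarrow> sorts_pvalues s (\<lambda>i. p i x) (\<sigma> x)"
    and "P \<in> \<Omega>"
  defines "E \<equiv> {x \<in> space P.
      FDP (stepdown_rejects s (\<lambda>i. alpha_const \<gamma> \<alpha> s i / D_const \<gamma> s) (\<lambda>i. p i x) (\<sigma> x))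
          (true_nulls s \<omega> P) > \<gamma>}"
  shows "E \<in> sets P \<and> measure P E \<le> \<alpha>"
proof (intro conjI)
  interpret prob_space P using model \<open>P \<in> \<Omega>\<close> by blast
  have setsP: "sets P = sets M" using model \<open>P \<in> \<Omega>\<close> by blast
  have space: "space P = space M" using setsP by (rule sets_eq_imp_space_eq)
  define I where "I = true_nulls s \<omega> P"
  define k where "k = card I"
  define D where "D = D_const \<gamma> s"
  define c where "c i = alpha_const \<gamma> \<alpha> s i / D" for i
  define b where "b i = \<alpha> / D * beta \<gamma> s k i" for i
  have I: "I \<subseteq> {1..s}" "finite I" "k \<le> s"
  proof -
    show I: "I \<subseteq> {1..s}" by (auto simp: I_def true_nulls_def)
    then show "finite I" using finite_subset by blast
    show "k \<le> s" using card_mono[OF _ I] by (simp add: k_def)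
  qed
  have S_le: "S_const \<gamma> s i \<le> D" if "i \<in> {1..s}" for i
    unfolding D_def D_const_def using that by (intro Max_ge) auto
  have D: "0 < D"
    using S_const_pos[of \<gamma> 1 s] S_le[of 1] assms(1-3) by simp
  have c_mono: "mono_on {1..s} c"
    using alpha_const_mono[of \<gamma> \<alpha> s] assms D
    by (auto simp: c_def mono_on_def intro!: divide_right_mono)
  have [measurable]: "p i \<in> borel_measurable P" if "i \<in> {1..s}" for i
    using pvalues_measurable[OF that] setsP by (simp cong: measurable_cong_sets)
  \<comment> \<open>The rejection set without \<sigma>: the ordering is not assumed measurable in x,
    so measurability of \<open>E\<close> is obtained through this form.\<close>
  define G where "G x = {i \<in> {1..s}. \<exists>r\<in>{1..s}. p i x \<le> c r \<and>
      (\<forall>j\<in>{1..r}. j \<le> card {l \<in> {1..s}. p l x \<le> c j})}" for x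
  have R: "stepdown_rejects s c (\<lambda>i. p i x) (\<sigma> x) = G x" if "x \<in> space P" for x
    unfolding G_def using ordering[of x] that space by (intro stepdown_rejects_eq c_mono) auto
  have E: "E = {x \<in> space P. FDP (stepdown_rejects s c (\<lambda>i. p i x) (\<sigma> x)) I > \<gamma>}"
    unfolding E_def c_def D_def I_def ..
  \<comment> \<open>Only finitely many rejection sets S are possible, so \<open>E\<close> is a
    finite union of events on which the rejection set is fixed.\<close>
  have E_G: "E = (\<Union>S\<in>{S \<in> Pow {1..s}. FDP S I > \<gamma>}. {x \<in> space P. G x = S})"
    unfolding E using R by (auto simp: G_def)
  show E_sets: "E \<in> sets P"
    unfolding E_G
  proof (intro sets.finite_UN)
    fix S assume "S \<in> {S \<in> Pow {1..s}. FDP S I > \<gamma>}"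
    then have "G x = S \<longleftrightarrow> (\<forall>i\<in>{1..s}. i \<in> S \<longleftrightarrow> (\<exists>r\<in>{1..s}. p i x \<le> c r \<and>
      (\<forall>j\<in>{1..r}. j \<le> card {l \<in> {1..s}. p l x \<le> c j})))" for x
      unfolding G_def by blast
    then show "{x \<in> space P. G x = S} \<in> sets P" by simp
  qed simp
  show "measure P E \<le> \<alpha>"
  \<comment> \<open>Without true nulls the proportion is 0; the maximum in \<open>D_const\<close>
    starts at cardinality 1.\<close>
  proof (cases "k = 0")
    case True
    then have "I = {}" using I by (simp add: k_def)
    then have "E = {}" using \<open>0 < \<gamma>\<close> by (auto simp: E FDP_def)
    then show ?thesis using \<open>0 < \<alpha>\<close> by simp
  next
    case False
    then have k: "1 \<le> k" by simp
    have "prob E \<le> real (card I) * (\<Sum>i=1..N_const \<gamma> s k. (b i - b (i - 1)) / real i)"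
    proof (rule prob_ordered_le)
      show "p l \<in> borel_measurable P" if "l \<in> I" for l using that I by auto
      show "mono b"
        using beta_mono[of \<gamma> k s] assms k D
        by (auto simp: b_def mono_def intro!: mult_left_mono divide_right_mono)
      show "b 0 = 0" by (simp add: b_def)
      show "prob {x \<in> space P. p l x \<le> b i} \<le> b i" if "l \<in> I" "1 \<le> i" for l i
      proof -
        \<comment> \<open>Validity is given only for levels strictly between 0 and 1. Positivity
          handles the lower end, and for \<open>b i\<close> at least 1 the bound is trivial.\<close>
        have "0 < b i" using beta_pos[of \<gamma> k i s] that k assms D by (simp add: b_def)
        moreover have "l \<in> {1..s}" "P \<in> \<omega> l" using that by (auto simp: I_def true_nulls_def)
        ultimately show ?thesis
          using pvalues_valid[of l P "b i"] prob_le_1 by (cases "b i < 1") (auto intro: order_trans)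
      qed
      show "\<exists>m\<in>{1..N_const \<gamma> s k}. m \<le> card {l \<in> I. p l x \<le> b m}" if "x \<in> E" for x
      proof -
        have x: "x \<in> space M" "FDP (stepdown_rejects s c (\<lambda>i. p i x) (\<sigma> x)) I > \<gamma>"
          using that space by (auto simp: E)
        obtain j m where jm: "j \<in> {1..s}" "m = card (\<sigma> x ` {1..j} \<inter> I)"
          "int m = \<lfloor>\<gamma> * real j\<rfloor> + 1" "real m - 1 \<le> \<gamma> * (real j - 1)" "j - m \<le> s - k"
          "m \<le> card {l \<in> I. p l x \<le> c j}" "m \<le> j"
          unfolding k_def
          by (rule FDP_exceeds_imp_first_index[OF ordering[OF x(1)] \<open>0 < \<gamma>\<close> I(1) x(2)])
        have "m \<le> k" unfolding k_def jm(2) using I(2) by (intro card_mono) auto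
        then have "m \<le> N_const \<gamma> s k"
          using index_le_N_const[OF assms(2,3) I(3) jm(1)] jm(3,4,7,5) by blast
        moreover have "1 \<le> m"
        proof -
          have "0 \<le> \<lfloor>\<gamma> * real j\<rfloor>" using \<open>0 < \<gamma>\<close> by simp
          then show ?thesis using jm(3) by linarith
        qed
        moreover have "c j \<le> b m"
          using alpha_const_le_beta[OF assms(2,3) less_imp_le[OF assms(4)] k I(3) jm(1,3,7,5)] D
          by (simp add: c_def b_def divide_right_mono)
        then have "card {l \<in> I. p l x \<le> c j} \<le> card {l \<in> I. p l x \<le> b m}"
          using I(2) by (intro card_mono) auto
        ultimately show ?thesis using jm(6) by (intro bexI[of _ m]) simp_all
      qed
    qed (use I E_sets in auto)
    also have "\<dots> = \<alpha> / D * S_const \<gamma> s k"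
      by (simp add: S_const_def k_def b_def sum_distrib_left right_diff_distrib diff_divide_distrib algebra_simps)
    \<comment> \<open>The maximum defining \<open>D_const\<close> covers the cardinality k, whatever
      it is under \<open>P\<close>.\<close>
    also have "\<dots> \<le> \<alpha> / D * D"
      using S_le[of k] k I D assms by (intro mult_left_mono) auto
    also have "\<dots> = \<alpha>" using D by simp
    finally show ?thesis .
  qed
qed

end
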